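(* Let $n\in\mathbb N$, $n\ge2$, and let $v,e\in(M_{2n})_a$ be two unitary elements. Then $v\sim_{h,t}e$ in $(M_{2n})_a$ if and only if $\det v=\det e$. Moreover, in this case there is a chain of $\sim_h$ in $(M_{2n})_a$ from $v$ to $e$ of length at most $2n-1$.
   Context: $(M_{2n})_a$ is the space of antisymmetric complex $2n\times 2n$ matrices ($x^t=-x$) with triple product $\{a,b,c\}=\frac12(ab^*c+cb^*a)$. A tripotent is $e\in (M_{2n})_a$ with $\{e,e,e\}=e$; it is unitary if $\{e,e,x\}=x$ for all $x\in (M_{2n})_a$ (equivalently, $e$ is a unitary matrix). For tripotents $u,e\in(M_{2n})_a$: $u\le_h e$ iff $u=\{e,u,e\}$; $u\sim_h e$ iff $u\le_he$ and $e\le_hu$; $u\le_{h,t}e$ iff there are tripotents $e=v_0,\dots,v_k=u$ in $(M_{2n})_a$ with $v_j\le_hv_{j-1}$ for all $j$; $u\sim_{h,t}e$ iff $u\le_{h,t}e$ and $e\le_{h,t}u$. A chain of $\sim_h$ of length $k$ from $u$ to $e$ consists of tripotents $u=w_0\sim_hw_1\sim_h\dots\sim_hw_k=e$ in $(M_{2n})_a$. *)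

theory Defs
  imports "Jordan_Normal_Form.Schur_Decomposition"
begin

text \<open>Throughout, \<open>m\<close> is the size of the matrices: \<open>antisym_mats m\<close> is the space $(M_m)_a$.\<close>

definition antisym_mats :: "nat \<Rightarrow> complex mat set" where
  "antisym_mats m = {x \<in> carrier_mat m m. transpose_mat x = - x}"

definition triple :: "complex mat \<Rightarrow> complex mat \<Rightarrow> complex mat \<Rightarrow> complex mat" where
  "triple a b c = (1/2) \<cdot>\<^sub>m (a * mat_adjoint b * c + c * mat_adjoint b * a)"

definition tripotent :: "nat \<Rightarrow> complex mat \<Rightarrow> bool" where
  "tripotent m e \<longleftrightarrow> e \<in> antisym_mats m \<and> triple e e e = e"

definition unitary_tripotent :: "nat \<Rightarrow> complex mat \<Rightarrow> bool" where
  "unitary_tripotent m e \<longleftrightarrow> tripotent m e \<and> (\<forall>x \<in> antisym_mats m. triple e e x = x)"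

text \<open>The relations below are relations between tripotents of $(M_m)_a$; they are false
  whenever one of the arguments is not such a tripotent.\<close>

definition le_h :: "nat \<Rightarrow> complex mat \<Rightarrow> complex mat \<Rightarrow> bool" where
  "le_h m u e \<longleftrightarrow> tripotent m u \<and> tripotent m e \<and> u = triple e u e"

definition sim_h :: "nat \<Rightarrow> complex mat \<Rightarrow> complex mat \<Rightarrow> bool" where
  "sim_h m u e \<longleftrightarrow> le_h m u e \<and> le_h m e u"

definition le_ht :: "nat \<Rightarrow> complex mat \<Rightarrow> complex mat \<Rightarrow> bool" where
  "le_ht m u e \<longleftrightarrow> (\<exists>(k::nat) v. v 0 = e \<and> v k = u \<and>
     (\<forall>j\<le>k. tripotent m (v j)) \<and> (\<forall>j\<in>{1..k}. le_h m (v j) (v (j - 1))))"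

definition sim_ht :: "nat \<Rightarrow> complex mat \<Rightarrow> complex mat \<Rightarrow> bool" where
  "sim_ht m u e \<longleftrightarrow> le_ht m u e \<and> le_ht m e u"

definition sim_h_chain :: "nat \<Rightarrow> nat \<Rightarrow> complex mat \<Rightarrow> complex mat \<Rightarrow> bool" where
  "sim_h_chain m k u e \<longleftrightarrow> (\<exists>w. w 0 = u \<and> w k = e \<and>
     (\<forall>j\<le>k. tripotent m (w j)) \<and> (\<forall>j<k. sim_h m (w j) (w (Suc j))))"

end

theory Submission
  imports Defs "Jordan_Normal_Form.Spectral_Radius"
begin

text \<open>
  Let \<open>v\<close> and \<open>e\<close> be antisymmetric unitaries of size \<open>2n\<close>. If \<open>x\<close> is an eigenvector of the unitary
  \<open>v e\<^sup>*\<close>, then so is \<open>e x\<^sup>-\<close> (with \<open>x\<^sup>-\<close> the entrywise conjugate), for the same eigenvalue, and it is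
  orthogonal to \<open>x\<close>. Splitting off such pairs one at a time gives isometries \<open>X, Y\<close> of size \<open>2n \<times> n\<close>
  with orthogonal ranges and a unitary diagonal matrix \<open>D\<close> such that \<open>e = F(1)\<close> and \<open>v = F(D)\<close>, where
  \<open>F(S) = X S Y\<^sup>T - Y S X\<^sup>T\<close>. In particular \<open>det v = (det D)\<^sup>2 det e\<close>.

  Since \<open>F(S) F(T)\<^sup>* F(R) = F(S T\<^sup>* R)\<close>, the relation \<open>v \<le>\<^sub>h e\<close> means \<open>D = D\<^sup>*\<close>, hence \<open>(det D)\<^sup>2 = 1\<close>;
  moreover every tripotent above a unitary one is unitary, so \<open>\<le>\<^sub>h\<^sub>,\<^sub>t\<close> preserves the determinant.
  Conversely, for symmetric unitary \<open>S, T\<close> with \<open>S T\<^sup>*\<close> Hermitian, \<open>F(S) \<sim>\<^sub>h F(T)\<close>. On two coordinates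
  \<open>diag(a, b)\<close> and \<open>diag(1, ab)\<close> are both related to the antidiagonal matrix with entries \<open>c, c\<close>,
  where \<open>c\<^sup>2 = ab\<close>. Hence \<open>2(n - 1)\<close> steps collect the whole determinant of \<open>D\<close> in the last entry, and
  if it is \<open>\<plusminus>1\<close> one more step leads to the identity.
\<close>

subsection \<open>Matrix algebra with dimension side conditions\<close>

definition conj_mat :: "complex mat \<Rightarrow> complex mat" where
  "conj_mat A = map_mat cnj A"

lemma dim_conj_mat [simp]: "dim_row (conj_mat A) = dim_row A" "dim_col (conj_mat A) = dim_col A"
  by (auto simp: conj_mat_def)

lemma dim_mat_adjoint [simp]:
  "dim_row (mat_adjoint A) = dim_col A" "dim_col (mat_adjoint A) = dim_row A"
  by (auto simp: mat_adjoint_def)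

lemma index_conj_mat [simp]:
  "i < dim_row A \<Longrightarrow> j < dim_col A \<Longrightarrow> conj_mat A $$ (i,j) = cnj (A $$ (i,j))"
  by (auto simp: conj_mat_def)

lemma index_mat_adjoint [simp]:
  fixes A :: "complex mat"
  shows "i < dim_col A \<Longrightarrow> j < dim_row A \<Longrightarrow> mat_adjoint A $$ (i,j) = cnj (A $$ (j,i))"
  by (auto simp: mat_adjoint_def mat_of_rows_def)

text \<open>Together with the identity the three operations form a Klein four-group; as simp rules
  these equations collapse every composition of two of them.\<close>

lemma conj_transpose_adjoint [simp]:
  fixes A :: "complex mat"
  shows "conj_mat (conj_mat A) = A" "conj_mat (mat_adjoint A) = A\<^sup>T" "conj_mat (A\<^sup>T) = mat_adjoint A"
    "mat_adjoint (conj_mat A) = A\<^sup>T" "mat_adjoint (mat_adjoint A) = A" "mat_adjoint (A\<^sup>T) = conj_mat A"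
    "(conj_mat A)\<^sup>T = mat_adjoint A" "(mat_adjoint A)\<^sup>T = conj_mat A"
  by (rule eq_matI; simp)+

text \<open>The side conditions are equations between dimensions instead of
  \<open>carrier_mat\<close> facts, so the simplifier can discharge them alone. Right-nested
  products are the normal form in all later computations.\<close>

lemma mult_mat_assoc:
  fixes A :: "complex mat"
  shows "dim_col A = dim_row B \<Longrightarrow> dim_col B = dim_row C \<Longrightarrow> A * B * C = A * (B * C)"
  by (rule assoc_mult_mat) auto

lemma mult_mat_distribs:
  fixes A :: "complex mat"
  shows "dim_row A = dim_row B \<Longrightarrow> dim_col A = dim_col B \<Longrightarrow> dim_col A = dim_row C \<Longrightarrow> (A + B) * C = A * C + B * C"
    "dim_row A = dim_row B \<Longrightarrow> dim_col A = dim_col B \<Longrightarrow> dim_col A = dim_row C \<Longrightarrow> (A - B) * C = A * C - B * C"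
    "dim_row A = dim_row B \<Longrightarrow> dim_col A = dim_col B \<Longrightarrow> dim_col C = dim_row A \<Longrightarrow> C * (A + B) = C * A + C * B"
    "dim_row A = dim_row B \<Longrightarrow> dim_col A = dim_col B \<Longrightarrow> dim_col C = dim_row A \<Longrightarrow> C * (A - B) = C * A - C * B"
    "dim_col A = dim_row C \<Longrightarrow> (- A) * C = - (A * C)"
    "dim_col A = dim_row C \<Longrightarrow> A * (- C) = - (A * C)"
    "dim_col A = dim_row C \<Longrightarrow> (k \<cdot>\<^sub>m A) * C = k \<cdot>\<^sub>m (A * C)"
    "dim_col A = dim_row C \<Longrightarrow> A * (k \<cdot>\<^sub>m C) = k \<cdot>\<^sub>m (A * C)"
  by (rule eq_matI;
      simp add: scalar_prod_def algebra_simps sum.distrib sum_subtractf sum_negf sum_distrib_left)+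

lemma conj_mat_ops:
  "dim_col A = dim_row B \<Longrightarrow> conj_mat (A * B) = conj_mat A * conj_mat B"
  "dim_row A = dim_row C \<Longrightarrow> dim_col A = dim_col C \<Longrightarrow> conj_mat (A + C) = conj_mat A + conj_mat C"
  "dim_row A = dim_row C \<Longrightarrow> dim_col A = dim_col C \<Longrightarrow> conj_mat (A - C) = conj_mat A - conj_mat C"
  "conj_mat (- A) = - conj_mat A" "conj_mat (k \<cdot>\<^sub>m A) = cnj k \<cdot>\<^sub>m conj_mat A"
  "conj_mat (1\<^sub>m l) = 1\<^sub>m l" "conj_mat (0\<^sub>m l l') = 0\<^sub>m l l'"
  by (rule eq_matI; simp add: scalar_prod_def)+

lemma transpose_mat_ops:
  fixes A :: "complex mat"
  shows "dim_col A = dim_row B \<Longrightarrow> (A * B)\<^sup>T = B\<^sup>T * A\<^sup>T"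
  "dim_row A = dim_row C \<Longrightarrow> dim_col A = dim_col C \<Longrightarrow> (A + C)\<^sup>T = A\<^sup>T + C\<^sup>T"
  "dim_row A = dim_row C \<Longrightarrow> dim_col A = dim_col C \<Longrightarrow> (A - C)\<^sup>T = A\<^sup>T - C\<^sup>T"
  "(- A)\<^sup>T = - (A\<^sup>T)" "(k \<cdot>\<^sub>m A)\<^sup>T = k \<cdot>\<^sub>m A\<^sup>T" "(1\<^sub>m l :: complex mat)\<^sup>T = 1\<^sub>m l"
  "(0\<^sub>m l l' :: complex mat)\<^sup>T = 0\<^sub>m l' l"
  by (rule eq_matI; simp add: scalar_prod_def mult.commute)+

lemma mat_adjoint_ops:
  fixes A :: "complex mat"
  shows "dim_col A = dim_row B \<Longrightarrow> mat_adjoint (A * B) = mat_adjoint B * mat_adjoint A"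
  "dim_row A = dim_row C \<Longrightarrow> dim_col A = dim_col C \<Longrightarrow> mat_adjoint (A + C) = mat_adjoint A + mat_adjoint C"
  "dim_row A = dim_row C \<Longrightarrow> dim_col A = dim_col C \<Longrightarrow> mat_adjoint (A - C) = mat_adjoint A - mat_adjoint C"
  "mat_adjoint (- A) = - mat_adjoint A" "mat_adjoint (k \<cdot>\<^sub>m A) = cnj k \<cdot>\<^sub>m mat_adjoint A"
  "mat_adjoint (1\<^sub>m l :: complex mat) = 1\<^sub>m l" "mat_adjoint (0\<^sub>m l l' :: complex mat) = 0\<^sub>m l' l"
  by (rule eq_matI; simp add: scalar_prod_def mult.commute)+

lemma mult_mat_trivial:
  fixes A :: "complex mat"
  shows "dim_row A = l \<Longrightarrow> 1\<^sub>m l * A = A" "dim_col A = l \<Longrightarrow> A * 1\<^sub>m l = A"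
  "dim_row A = l \<Longrightarrow> 0\<^sub>m k l * A = 0\<^sub>m k (dim_col A)" "dim_col A = l \<Longrightarrow> A * 0\<^sub>m l k = 0\<^sub>m (dim_row A) k"
  "dim_row A = r \<Longrightarrow> dim_col A = c \<Longrightarrow> A + 0\<^sub>m r c = A" 
  "dim_row A = r \<Longrightarrow> dim_col A = c \<Longrightarrow> 0\<^sub>m r c + A = A"
  "dim_row A = r \<Longrightarrow> dim_col A = c \<Longrightarrow> A - 0\<^sub>m r c = A" 
  "dim_row A = r \<Longrightarrow> dim_col A = c \<Longrightarrow> 0\<^sub>m r c - A = - A"
  by (rule eq_matI; simp)+

lemma smult_smult_mat: "(a :: complex) \<cdot>\<^sub>m (b \<cdot>\<^sub>m A) = (a * b) \<cdot>\<^sub>m A"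
  by (rule eq_matI) auto

lemma one_smult_mat [simp]: "(1 :: complex) \<cdot>\<^sub>m A = A"
  by (rule eq_matI) auto

lemma smult_uminus_mat: "(a :: complex) \<cdot>\<^sub>m (- A) = - (a \<cdot>\<^sub>m A)"
  by (rule eq_matI) auto

lemmas mat_algebra = mult_mat_assoc mult_mat_distribs conj_mat_ops transpose_mat_ops mat_adjoint_ops mult_mat_trivial

text \<open>In a right-nested product the pair \<open>A * B\<close> no longer occurs as a subterm of
  \<open>A * (B * D)\<close>; this turns a relation for the pair into a rewrite rule that still
  applies there.\<close>

lemma mult_mat_cancel_left:
  fixes A :: "complex mat"
  assumes "A * B = C" "dim_col A = dim_row B" "dim_col B = dim_row D"
  shows "A * (B * D) = C * D"
  using assms by (metis mult_mat_assoc)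

lemma left_inverse_imp_right_inverse:
  fixes A :: "complex mat"
  assumes "A * B = 1\<^sub>m m" "A \<in> carrier_mat m m" "B \<in> carrier_mat m m"
  shows "B * A = 1\<^sub>m m"
  using mat_mult_left_right_inverse[OF assms(2,3,1)] .

section \<open>Diagonal matrices\<close>

definition diag_of :: "nat \<Rightarrow> (nat \<Rightarrow> complex) \<Rightarrow> complex mat" where
  "diag_of n d = mat n n (\<lambda>(i,j). if j = i then d i else 0)"

lemma dim_diag_of [simp]: "dim_row (diag_of n d) = n" "dim_col (diag_of n d) = n"
  by (auto simp: diag_of_def)

lemma adjoint_diag_of: "mat_adjoint (diag_of n d) = diag_of n (\<lambda>i. cnj (d i))"
  by (rule eq_matI) (auto simp: diag_of_def)

lemma transpose_diag_of: "(diag_of n d)\<^sup>T = diag_of n d"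
  by (rule eq_matI) (auto simp: diag_of_def)

lemma diag_of_one: "diag_of n (\<lambda>_. 1) = 1\<^sub>m n"
  by (rule eq_matI) (auto simp: diag_of_def)

lemma index_mult_diag_of:
  "dim_col A = n \<Longrightarrow> i < dim_row A \<Longrightarrow> j < n \<Longrightarrow> (A * diag_of n d) $$ (i,j) = A $$ (i,j) * d j"
  by (simp add: scalar_prod_def diag_of_def if_distrib[of "\<lambda>x. _ * x"] sum.delta cong: if_cong)

lemma det_diag_of: "det (diag_of n d) = (\<Prod>i<n. d i)"
proof -
  have "det (diag_of n d) = prod_list (diag_mat (diag_of n d))"
    by (rule det_upper_triangular[of _ n]) (auto simp: diag_of_def)
  also have "diag_mat (diag_of n d) = map d [0..<n]"
    by (auto simp: diag_mat_def diag_of_def)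
  also have "prod_list \<dots> = (\<Prod>i<n. d i)"
    by (simp add: prod.distinct_set_conv_list[symmetric] lessThan_atLeast0)
  finally show ?thesis .
qed

section \<open>Matrices put side by side\<close>

definition hcat :: "complex mat \<Rightarrow> complex mat \<Rightarrow> complex mat" where
  "hcat A B = mat (dim_row A) (dim_col A + dim_col B)
     (\<lambda>(i,j). if j < dim_col A then A $$ (i,j) else B $$ (i, j - dim_col A))"

lemma dim_hcat [simp]: "dim_row (hcat A B) = dim_row A" "dim_col (hcat A B) = dim_col A + dim_col B"
  by (auto simp: hcat_def)

lemma sum_split_add:
  fixes f :: "nat \<Rightarrow> 'a :: comm_monoid_add"
  shows "(\<Sum>i = 0..<a + b. f i) = (\<Sum>i = 0..<a. f i) + (\<Sum>i = 0..<b. f (a + i))"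
  by (induct b) (auto simp: algebra_simps)

text \<open>The transpose is the form that occurs in \<open>frame\<close>; with a conjugated second
  factor the same rule yields products with an adjoint.\<close>

lemma hcat_mult_transpose:
  assumes "dim_row A = dim_row B" "dim_row C = dim_row D" "dim_col A = dim_col C" "dim_col B = dim_col D"
  shows "hcat A B * (hcat C D)\<^sup>T = A * C\<^sup>T + B * D\<^sup>T"
  using assms by (intro eq_matI) (simp_all add: hcat_def scalar_prod_def sum_split_add)

lemma mult_hcat:
  assumes "dim_row A = dim_row B" "dim_col C = dim_row A"
  shows "C * hcat A B = hcat (C * A) (C * B)"
  using assms by (intro eq_matI) (auto simp add: hcat_def scalar_prod_def)

lemma adjoint_hcat_mult_hcat:
  assumes "dim_row A = dim_row B" "dim_row C = dim_row A" "dim_row D = dim_row A"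
  shows "mat_adjoint (hcat A B) * hcat C D =
    four_block_mat (mat_adjoint A * C) (mat_adjoint A * D) (mat_adjoint B * C) (mat_adjoint B * D)"
  using assms by (intro eq_matI) (auto simp add: hcat_def scalar_prod_def)

lemma adjoint_hcat_mult_eq_zeroD:
  assumes "mat_adjoint (hcat A B) * C = 0\<^sub>m k l"
    and dims: "dim_row A = dim_row B" "dim_row C = dim_row A"
  shows "mat_adjoint A * C = 0\<^sub>m (dim_col A) l" "mat_adjoint B * C = 0\<^sub>m (dim_col B) l"
proof -
  \<comment> \<open>A vertical stack is written as a four-block matrix whose right-hand blocks have
    no columns.\<close>
  have "mat_adjoint (hcat A B) * C = four_block_mat (mat_adjoint A * C) (0\<^sub>m (dim_col A) 0)
      (mat_adjoint B * C) (0\<^sub>m (dim_col B) 0)"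
    using dims by (intro eq_matI) (auto simp: hcat_def scalar_prod_def)
  then have *: "four_block_mat (mat_adjoint A * C) (0\<^sub>m (dim_col A) 0)
      (mat_adjoint B * C) (0\<^sub>m (dim_col B) 0) = 0\<^sub>m k l" using assms(1) by simp
  have k: "k = dim_col A + dim_col B" and l: "dim_col C = l"
    using arg_cong[OF *, of dim_row] arg_cong[OF *, of dim_col] by simp_all
  show "mat_adjoint A * C = 0\<^sub>m (dim_col A) l"
  proof (rule eq_matI)
    fix i j assume "i < dim_row (0\<^sub>m (dim_col A) l)" "j < dim_col (0\<^sub>m (dim_col A) l)"
    then show "(mat_adjoint A * C) $$ (i,j) = 0\<^sub>m (dim_col A) l $$ (i,j)"
      using arg_cong[OF *, of "\<lambda>a. a $$ (i,j)"] k l by (simp del: index_mult_mat(1))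
  qed (use l in auto)
  show "mat_adjoint B * C = 0\<^sub>m (dim_col B) l"
  proof (rule eq_matI)
    fix i j assume "i < dim_row (0\<^sub>m (dim_col B) l)" "j < dim_col (0\<^sub>m (dim_col B) l)"
    then show "(mat_adjoint B * C) $$ (i,j) = 0\<^sub>m (dim_col B) l $$ (i,j)"
      using arg_cong[OF *, of "\<lambda>a. a $$ (dim_col A + i,j)"] k l by (simp del: index_mult_mat(1))
  qed (use l in auto)
qed

lemma adjoint_mult_zero_sym:
  fixes A :: "complex mat"
  assumes "mat_adjoint A * B = 0\<^sub>m r c" "dim_row A = dim_row B"
  shows "mat_adjoint B * A = 0\<^sub>m c r"
  using arg_cong[OF assms(1), of mat_adjoint] assms(2) by (simp add: mat_algebra)

lemma conj_hcat: "dim_row A = dim_row B \<Longrightarrow> conj_mat (hcat A B) = hcat (conj_mat A) (conj_mat B)"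
  by (rule eq_matI) (auto simp: hcat_def)

lemma hcat_mult_four_block_diag:
  assumes "dim_row A = dim_row B" "dim_col A = dim_row D" "dim_col D = dim_row D" "dim_col B = dim_row E" "dim_col E = dim_row E"
  shows "hcat A B * four_block_mat D (0\<^sub>m (dim_row D) (dim_col E)) (0\<^sub>m (dim_row E) (dim_col D)) E = hcat (A * D) (B * E)"
  using assms by (intro eq_matI) (auto simp add: hcat_def scalar_prod_def sum_split_add)

subsection \<open>Orthonormal complements and eigenvectors\<close>

text \<open>From here on vectors are carried as one-column matrices, so that everything stays inside
  the same matrix calculus.\<close>

lemma normalize_column:
  fixes u :: "complex vec"
  assumes u: "u \<in> carrier_vec m" "u \<noteq> 0\<^sub>v m"
  defines "x \<equiv> mat m 1 (\<lambda>(i,j). u $ i)"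
  shows "\<exists>c. mat_adjoint (c \<cdot>\<^sub>m x) * (c \<cdot>\<^sub>m x) = 1\<^sub>m 1"
proof -
  define s where "s = (\<Sum>i=0..<m. (cmod (u $ i))\<^sup>2)"
  have "\<exists>i<m. u $ i \<noteq> 0"
  proof (rule ccontr)
    assume "\<not> ?thesis"
    then have "u = 0\<^sub>v m"
      using u by (intro eq_vecI) auto
    then show False using u by simp
  qed
  then obtain i where "i < m" "u $ i \<noteq> 0" by auto
  then have "s > 0"
    unfolding s_def by (intro sum_pos2[of _ i]) auto
  define c where "c = complex_of_real (1 / sqrt s)"
  have s: "(\<Sum>i=0..<m. cnj (u $ i) * u $ i) = complex_of_real s"
    unfolding s_def by (simp add: complex_norm_square mult.commute del: of_real_power)
  have "cnj c * c * complex_of_real s = 1"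
    using \<open>s > 0\<close> by (simp add: c_def flip: of_real_mult)
  then have "mat_adjoint (c \<cdot>\<^sub>m x) * (c \<cdot>\<^sub>m x) = 1\<^sub>m 1"
    by (intro eq_matI)
      (auto simp: x_def scalar_prod_def s[symmetric] sum_distrib_left mult_ac)
  then show ?thesis by blast
qed

text \<open>Padding the adjoint of \<open>Z\<close> with zero rows gives a square matrix
  \<open>B\<close>, singular because \<open>k < m\<close>; a normalized kernel vector of
  \<open>B\<close> is orthogonal to every column of \<open>Z\<close>.\<close>

lemma exists_orthogonal_unit_column:
  fixes Z :: "complex mat"
  assumes "dim_row Z = m" "dim_col Z = k" "k < m"
  shows "\<exists>z. dim_row z = m \<and> dim_col z = 1 \<and> mat_adjoint z * z = 1\<^sub>m 1 \<and> mat_adjoint Z * z = 0\<^sub>m k 1"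
proof -
  define B where "B = mat m m (\<lambda>(i,j). if i < k then cnj (Z $$ (j,i)) else 0)"
  have B: "B \<in> carrier_mat m m" by (simp add: B_def)
  \<comment> \<open>Row \<open>k\<close> of \<open>B\<close> is the first padded row, hence zero,
    which exhibits a kernel vector of the transpose.\<close>
  have "B\<^sup>T *\<^sub>v unit_vec m k = 0\<^sub>v m"
    using assms by (intro eq_vecI) (auto simp: B_def)
  moreover have "unit_vec m k \<noteq> (0\<^sub>v m :: complex vec)"
    using assms by (simp add: unit_vec_nonzero)
  ultimately have "det (B\<^sup>T) = 0"
    using det_0_iff_vec_prod_zero_field[of "B\<^sup>T" m] B unit_vec_carrier by (metis transpose_carrier_mat)
  then have "det B = 0" using det_transpose[OF B] by simp
  then obtain u where u: "u \<in> carrier_vec m" "u \<noteq> 0\<^sub>v m" "B *\<^sub>v u = 0\<^sub>v m"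
    using det_0_iff_vec_prod_zero_field[OF B] by auto
  define x where "x = mat m 1 (\<lambda>(i,j). u $ i)"
  have dx: "dim_row x = m" "dim_col x = 1" by (auto simp: x_def)
  obtain c where c: "mat_adjoint (c \<cdot>\<^sub>m x) * (c \<cdot>\<^sub>m x) = 1\<^sub>m 1"
    using normalize_column[OF u(1,2)] unfolding x_def by blast
  have "mat_adjoint Z * x = 0\<^sub>m k 1"
  proof (rule eq_matI)
    fix i j assume "i < dim_row (0\<^sub>m k 1)" "j < dim_col (0\<^sub>m k 1)"
    then have ij: "i < k" "j = 0" by auto
    have "(B *\<^sub>v u) $ i = 0" using u ij assms by simp
    then show "(mat_adjoint Z * x) $$ (i,j) = 0\<^sub>m k 1 $$ (i,j)"
      using ij assms u by (simp add: scalar_prod_def B_def x_def)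
  qed (use assms dx in auto)
  then have "mat_adjoint Z * (c \<cdot>\<^sub>m x) = 0\<^sub>m k 1"
    using dx assms by (simp add: mat_algebra)
  with c dx show ?thesis by (intro exI[of _ "c \<cdot>\<^sub>m x"]) auto
qed

text \<open>Induction on the number \<open>l\<close> of missing columns: one orthogonal unit column
  \<open>z\<close> is appended to \<open>Z\<close>, and the complement of \<open>hcat Z z\<close>
  together with \<open>z\<close> is the one sought.\<close>

lemma isometry_complement:
  fixes Z :: "complex mat"
  assumes "dim_row Z = k + l" "dim_col Z = k" "mat_adjoint Z * Z = 1\<^sub>m k"
  shows "\<exists>W. dim_row W = k + l \<and> dim_col W = l \<and> mat_adjoint W * W = 1\<^sub>m l \<and> mat_adjoint Z * W = 0\<^sub>m k l"
  using assms
proof (induction l arbitrary: Z k)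
  case 0
  then show ?case by (intro exI[of _ "0\<^sub>m k 0"]) (auto intro!: eq_matI)
next
  case (Suc l)
  note Z [simp] = Suc.prems
  obtain z where z [simp]: "dim_row z = k + Suc l" "dim_col z = 1" "mat_adjoint z * z = 1\<^sub>m 1"
      "mat_adjoint Z * z = 0\<^sub>m k 1"
    using exists_orthogonal_unit_column[of Z "k + Suc l" k] Suc.prems by auto
  have zZ [simp]: "mat_adjoint z * Z = 0\<^sub>m 1 k"
    using z(4) by (rule adjoint_mult_zero_sym) simp
  have "mat_adjoint (hcat Z z) * hcat Z z = 1\<^sub>m (k + 1)"
    by (simp add: adjoint_hcat_mult_hcat)
  from Suc.IH[of "hcat Z z" "k + 1"] this
  obtain W where W [simp]: "dim_row W = k + Suc l" "dim_col W = l" "mat_adjoint W * W = 1\<^sub>m l"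
      and ZW: "mat_adjoint (hcat Z z) * W = 0\<^sub>m (k + 1) l" by auto
  have ZW' [simp]: "mat_adjoint Z * W = 0\<^sub>m k l" and zW [simp]: "mat_adjoint z * W = 0\<^sub>m 1 l"
    using adjoint_hcat_mult_eq_zeroD[OF ZW] by simp_all
  have Wz [simp]: "mat_adjoint W * z = 0\<^sub>m l 1"
    using zW by (rule adjoint_mult_zero_sym) simp
  have "mat_adjoint (hcat z W) * hcat z W = 1\<^sub>m (Suc l)"
    by (simp add: adjoint_hcat_mult_hcat)
  moreover have "hcat (0\<^sub>m k 1) (0\<^sub>m k l) = 0\<^sub>m k (Suc l)"
    by (rule eq_matI) (auto simp: hcat_def)
  ultimately show ?case
    by (intro exI[of _ "hcat z W"]) (simp_all add: mult_hcat[of z W "mat_adjoint Z"])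
qed

lemma exists_unit_eigencolumn:
  fixes g :: "complex mat"
  assumes "g \<in> carrier_mat m m" "m > 0"
  shows "\<exists>x a. dim_row x = m \<and> dim_col x = 1 \<and> mat_adjoint x * x = 1\<^sub>m 1 \<and> g * x = a \<cdot>\<^sub>m x"
proof -
  obtain a where "eigenvalue g a"
    using spectrum_non_empty[of g m] assms unfolding spectrum_def by auto
  then obtain u where u: "u \<in> carrier_vec m" "u \<noteq> 0\<^sub>v m" "g *\<^sub>v u = a \<cdot>\<^sub>v u"
    using assms unfolding eigenvalue_def eigenvector_def by auto
  define x where "x = mat m 1 (\<lambda>(i,j). u $ i)"
  have dx: "dim_row x = m" "dim_col x = 1" by (auto simp: x_def)
  obtain c where c: "mat_adjoint (c \<cdot>\<^sub>m x) * (c \<cdot>\<^sub>m x) = 1\<^sub>m 1"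
    using normalize_column[OF u(1,2)] unfolding x_def by blast
  have gx: "g * x = a \<cdot>\<^sub>m x"
  proof (rule eq_matI)
    fix i j assume "i < dim_row (a \<cdot>\<^sub>m x)" "j < dim_col (a \<cdot>\<^sub>m x)"
    then have ij: "i < m" "j = 0" using dx by auto
    show "(g * x) $$ (i,j) = (a \<cdot>\<^sub>m x) $$ (i,j)"
      using arg_cong[OF u(3), of "\<lambda>w. w $ i"] ij assms u(1) by (simp add: scalar_prod_def x_def)
  qed (use assms dx in auto)
  have "g * (c \<cdot>\<^sub>m x) = a \<cdot>\<^sub>m (c \<cdot>\<^sub>m x)"
    using dx assms gx by (simp add: mat_algebra smult_smult_mat mult.commute)
  with c dx show ?thesis by (intro exI[of _ "c \<cdot>\<^sub>m x"] exI[of _ a]) auto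
qed

subsection \<open>Joint normal form of two antisymmetric unitaries\<close>

text \<open>With U = \<open>hcat X Y\<close> this is U J U^T, where J has the block rows (0, S) and
  (-S, 0); symmetric \<open>S\<close> therefore give antisymmetric matrices.\<close>

definition frame :: "complex mat \<Rightarrow> complex mat \<Rightarrow> complex mat \<Rightarrow> complex mat" where
  "frame X Y S = X * S * Y\<^sup>T - Y * S * X\<^sup>T"

text \<open>Since \<open>t\<close> sends the conjugates of \<open>x\<close> and \<open>y\<close>
  into the span of \<open>x\<close> and \<open>y\<close>, the rest \<open>r\<close> is supported on
  \<open>W\<close> from the right, and by antisymmetry also from the left. So compressing to
  \<open>W\<close> loses nothing, and \<open>t'\<close> is again an antisymmetric unitary.\<close>

lemma compress_antisymmetric:
  fixes t x y W :: "complex mat"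
  assumes dims [simp]: "dim_row t = m" "dim_col t = m" "dim_row x = m" "dim_col x = 1"
      "dim_row y = m" "dim_col y = 1" "dim_row W = m" "dim_col W = l"
    and t: "t\<^sup>T = - t" "t * mat_adjoint t = 1\<^sub>m m"
    and W: "mat_adjoint W * W = 1\<^sub>m l"
    and res: "x * mat_adjoint x + y * mat_adjoint y + W * mat_adjoint W = 1\<^sub>m m"
    and tx: "t * conj_mat x = - (a \<cdot>\<^sub>m y)" and ty: "t * conj_mat y = a \<cdot>\<^sub>m x"
  defines "t' \<equiv> mat_adjoint W * t * conj_mat W"
  shows "t'\<^sup>T = - t'" "t' * mat_adjoint t' = 1\<^sub>m l"
    "t = a \<cdot>\<^sub>m (x * y\<^sup>T - y * x\<^sup>T) + W * t' * W\<^sup>T"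
proof -
  define r where "r = t - a \<cdot>\<^sub>m (x * y\<^sup>T - y * x\<^sup>T)"
  have dr [simp]: "dim_row r = m" "dim_col r = m" by (simp_all add: r_def)
  have rT: "r\<^sup>T = - r"
    unfolding r_def by (simp add: mat_algebra t) (rule eq_matI; simp add: algebra_simps)
  \<comment> \<open>\<open>t\<close> acts on conjugated columns, so the resolution of the identity
    is needed in conjugated form.\<close>
  have "conj_mat (x * mat_adjoint x + y * mat_adjoint y + W * mat_adjoint W) = 1\<^sub>m m"
    unfolding res by (simp add: mat_algebra)
  then have cres: "conj_mat x * x\<^sup>T + conj_mat y * y\<^sup>T + conj_mat W * W\<^sup>T = 1\<^sub>m m"
    by (simp add: mat_algebra)
  have tcx: "t * (conj_mat x * x\<^sup>T) = - (a \<cdot>\<^sub>m (y * x\<^sup>T))"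
    by (subst mult_mat_cancel_left[OF tx]) (simp_all add: mat_algebra)
  have tcy: "t * (conj_mat y * y\<^sup>T) = a \<cdot>\<^sub>m (x * y\<^sup>T)"
    by (subst mult_mat_cancel_left[OF ty]) (simp_all add: mat_algebra)
  have "t = t * (conj_mat x * x\<^sup>T + conj_mat y * y\<^sup>T + conj_mat W * W\<^sup>T)"
    unfolding cres by (simp add: mat_algebra)
  also have "\<dots> = - (a \<cdot>\<^sub>m (y * x\<^sup>T)) + a \<cdot>\<^sub>m (x * y\<^sup>T) + t * (conj_mat W * W\<^sup>T)"
    by (simp add: mat_algebra tcx tcy)
  finally have *: "t = - (a \<cdot>\<^sub>m (y * x\<^sup>T)) + a \<cdot>\<^sub>m (x * y\<^sup>T) + t * (conj_mat W * W\<^sup>T)" .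
  have tQ: "t * (conj_mat W * W\<^sup>T) = r"
  proof (rule eq_matI)
    fix i j assume "i < dim_row r" "j < dim_col r"
    then have ij: "i < m" "j < m" by simp_all
    show "(t * (conj_mat W * W\<^sup>T)) $$ (i,j) = r $$ (i,j)"
      using arg_cong[OF *, of "\<lambda>a. a $$ (i,j)"] ij
      by (simp add: r_def algebra_simps del: index_mult_mat(1))
  qed simp_all
  \<comment> \<open>Transposing turns the projection on the right of \<open>t\<close> into the
    projection onto the range of \<open>W\<close> on its left.\<close>
  have "(t * (conj_mat W * W\<^sup>T))\<^sup>T = - r" using tQ rT by simp
  then have "- (W * (mat_adjoint W * t)) = - r" by (simp add: mat_algebra t)
  then have Qt: "W * (mat_adjoint W * t) = r"
    by (metis uminus_uminus_mat)
  show "t'\<^sup>T = - t'" by (simp add: t'_def mat_algebra t)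
  have "W * t' * W\<^sup>T = W * (mat_adjoint W * (t * (conj_mat W * W\<^sup>T)))"
    by (simp add: t'_def mat_algebra)
  also have "\<dots> = W * ((mat_adjoint W * W) * (mat_adjoint W * t))"
    by (simp add: tQ Qt[symmetric] mat_algebra)
  also have "\<dots> = r" by (simp add: W mat_algebra Qt)
  finally have "W * t' * W\<^sup>T = r" .
  then show "t = a \<cdot>\<^sub>m (x * y\<^sup>T - y * x\<^sup>T) + W * t' * W\<^sup>T"
    by (simp add: r_def) (rule eq_matI; simp)
  \<comment> \<open>The inner projection is moved from the right of \<open>t\<close> to its left,
    where \<open>W\<close> meets its own adjoint and cancels.\<close>
  have "t' * mat_adjoint t' = mat_adjoint W * ((t * (conj_mat W * W\<^sup>T)) * (mat_adjoint t * W))"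
    by (simp add: t'_def mat_algebra)
  also have "\<dots> = mat_adjoint W * W * (mat_adjoint W * ((t * mat_adjoint t) * W))"
    by (simp add: tQ Qt[symmetric] mat_algebra)
  also have "\<dots> = 1\<^sub>m l" by (simp add: t W mat_algebra)
  finally show "t' * mat_adjoint t' = 1\<^sub>m l" .
qed

text \<open>\<open>case_nat a d\<close> is the sequence \<open>d\<close> with \<open>a\<close> put
  in front, matching the new first column.\<close>

lemma hcat_mult_diag_of:
  assumes "dim_row A = dim_row x" "dim_col x = 1" "dim_col A = n"
  shows "hcat x A * diag_of (Suc n) (case_nat a d) = hcat (a \<cdot>\<^sub>m x) (A * diag_of n d)"
  by (rule eq_matI)
    (use assms in \<open>auto simp: index_mult_diag_of hcat_def split: nat.splits simp del: index_mult_mat(1)\<close>)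

text \<open>The right-hand side has the shape in which \<open>compress_antisymmetric\<close> returns
  \<open>t\<close>, so a frame for the compression extends to one for the whole matrix.\<close>

lemma frame_hcat:
  assumes [simp]: "dim_row x = m" "dim_col x = 1" "dim_row y = m" "dim_col y = 1"
      "dim_row W = m" "dim_col W = l" "dim_row X = l" "dim_col X = n" "dim_row Y = l" "dim_col Y = n"
  shows "frame (hcat x (W * X)) (hcat y (W * Y)) (diag_of (Suc n) (case_nat a d)) =
    a \<cdot>\<^sub>m (x * y\<^sup>T - y * x\<^sup>T) + W * frame X Y (diag_of n d) * W\<^sup>T"
proof -
  have "frame (hcat x (W * X)) (hcat y (W * Y)) (diag_of (Suc n) (case_nat a d)) =
    (a \<cdot>\<^sub>m (x * y\<^sup>T) + W * (X * (diag_of n d * (Y\<^sup>T * W\<^sup>T))))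
     - (a \<cdot>\<^sub>m (y * x\<^sup>T) + W * (Y * (diag_of n d * (X\<^sup>T * W\<^sup>T))))"
    unfolding frame_def
    by (simp add: hcat_mult_diag_of hcat_mult_transpose mat_algebra)
  also have "\<dots> = a \<cdot>\<^sub>m (x * y\<^sup>T - y * x\<^sup>T) + W * frame X Y (diag_of n d) * W\<^sup>T"
    by (simp add: frame_def mat_algebra) (rule eq_matI; simp add: algebra_simps del: index_mult_mat(1))
  finally show ?thesis .
qed

text \<open>Induction on \<open>n\<close>. Each step compresses \<open>v\<close> and
  \<open>e\<close> with the same \<open>W\<close>, which is why one pair \<open>X\<close>,
  \<open>Y\<close> serves both; \<open>v\<close> contributes the eigenvalue \<open>a\<close> and
  \<open>e\<close> the coefficient 1.\<close>

theorem antisymmetric_unitary_pair_frame: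
  assumes "v \<in> antisym_mats (2 * n)" "v * mat_adjoint v = 1\<^sub>m (2 * n)"
    and "e \<in> antisym_mats (2 * n)" "e * mat_adjoint e = 1\<^sub>m (2 * n)"
  shows "\<exists>X Y d. X \<in> carrier_mat (2 * n) n \<and> Y \<in> carrier_mat (2 * n) n \<and>
    mat_adjoint X * X = 1\<^sub>m n \<and> mat_adjoint Y * Y = 1\<^sub>m n \<and> mat_adjoint X * Y = 0\<^sub>m n n \<and>
    (\<forall>i<n. d i * cnj (d i) = 1) \<and> e = frame X Y (1\<^sub>m n) \<and> v = frame X Y (diag_of n d)"
  using assms
proof (induction n arbitrary: v e)
  case 0
  then show ?case
    by (intro exI[of _ "0\<^sub>m 0 0"]) (auto simp: frame_def antisym_mats_def intro!: eq_matI)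
next
  case (Suc n)
  define m where "m = 2 * Suc n"
  have "m > 0" by (simp add: m_def)
  have [simp]: "dim_row v = m" "dim_col v = m" "dim_row e = m" "dim_col e = m"
    and vT: "v\<^sup>T = - v" and eT: "e\<^sup>T = - e"
    and vv: "v * mat_adjoint v = 1\<^sub>m m" and ee: "e * mat_adjoint e = 1\<^sub>m m"
    using Suc.prems by (auto simp: antisym_mats_def m_def)
  have vv': "mat_adjoint v * v = 1\<^sub>m m" and ee': "mat_adjoint e * e = 1\<^sub>m m"
    using left_inverse_imp_right_inverse[OF vv] left_inverse_imp_right_inverse[OF ee]
    by (simp_all add: carrier_matI)
  have va: "mat_adjoint v = - conj_mat v" and ea: "mat_adjoint e = - conj_mat e"
    using arg_cong[OF vT, of conj_mat] arg_cong[OF eT, of conj_mat] by (simp_all add: mat_algebra)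
  have neg: "A = - B" if "- A = B" for A B :: "complex mat"
    using that by (metis uminus_uminus_mat)
  \<comment> \<open>The antilinear maps sending z to v conj(z) and to e conj(z) square to -1; this
    quaternionic structure is what produces eigenvectors in pairs.\<close>
  have vc: "v * conj_mat v = - 1\<^sub>m m" and ec: "e * conj_mat e = - 1\<^sub>m m"
    using vv ee by (auto simp: va ea mat_algebra intro!: neg)
  obtain x a where [simp]: "dim_row x = m" "dim_col x = 1" and xx: "mat_adjoint x * x = 1\<^sub>m 1"
    and ax: "(v * mat_adjoint e) * x = a \<cdot>\<^sub>m x"
    using exists_unit_eigencolumn[of "v * mat_adjoint e" m] \<open>m > 0\<close> carrier_matI[of "v * mat_adjoint e" m m]
    by auto
  \<comment> \<open>The sign makes \<open>e\<close> satisfy the hypotheses of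
    \<open>compress_antisymmetric\<close> with coefficient 1.\<close>
  define y where "y = - (e * conj_mat x)"
  have [simp]: "dim_row y = m" "dim_col y = 1" by (simp_all add: y_def)
  have ex: "e * conj_mat x = - y" by (simp add: y_def)
  have ey: "e * conj_mat y = x"
    by (simp add: y_def mat_algebra mult_mat_cancel_left[OF ec])
  have xx': "x\<^sup>T * conj_mat x = 1\<^sub>m 1"
    using arg_cong[OF xx, of transpose_mat] by (simp add: mat_algebra)
  have yy: "mat_adjoint y * y = 1\<^sub>m 1"
    using xx' by (simp add: y_def mat_algebra mult_mat_cancel_left[OF ee'])
  have yy': "y\<^sup>T * conj_mat y = 1\<^sub>m 1"
    using arg_cong[OF yy, of transpose_mat] by (simp add: mat_algebra)
  \<comment> \<open>Up to sign this scalar is an antisymmetric bilinear form evaluated twice at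
    conj(x), so it equals its own negative.\<close>
  have "(mat_adjoint x * y)\<^sup>T = - (mat_adjoint x * y)"
    by (simp add: y_def mat_algebra eT)
  then have "(mat_adjoint x * y)\<^sup>T $$ (0,0) = (- (mat_adjoint x * y)) $$ (0,0)" by simp
  then have xy: "mat_adjoint x * y = 0\<^sub>m 1 1"
    by (intro eq_matI) (simp_all del: index_mult_mat(1))
  have yx: "mat_adjoint y * x = 0\<^sub>m 1 1" using xy by (rule adjoint_mult_zero_sym) simp
  have vy: "v * conj_mat y = a \<cdot>\<^sub>m x"
  proof -
    have "v * conj_mat y = (v * mat_adjoint e) * (e * conj_mat y)"
      by (simp add: mat_algebra mult_mat_cancel_left[OF ee'])
    then show ?thesis by (simp add: ey ax)
  qed
  have aa: "a * cnj a = 1"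
  proof -
    have "mat_adjoint (v * conj_mat y) * (v * conj_mat y) = 1\<^sub>m 1"
      by (simp add: mat_algebra mult_mat_cancel_left[OF vv'] yy')
    then have "(a * cnj a) \<cdot>\<^sub>m 1\<^sub>m 1 = (1\<^sub>m 1 :: complex mat)"
      by (simp add: vy mat_algebra xx smult_smult_mat)
    from arg_cong[OF this, of "\<lambda>A. A $$ (0,0)"] show ?thesis by simp
  qed
  \<comment> \<open>Applying the antilinear map of \<open>v\<close> to both sides of
    \<open>vy\<close> gives -y on the left and \<open>cnj a\<close> times
    \<open>v * conj_mat x\<close> on the right; multiplying by \<open>a\<close> removes the
    factor.\<close>
  have vx: "v * conj_mat x = - (a \<cdot>\<^sub>m y)"
  proof -
    have "conj_mat (v * conj_mat y) = cnj a \<cdot>\<^sub>m conj_mat x"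
      by (simp add: vy mat_algebra)
    then have *: "conj_mat v * y = cnj a \<cdot>\<^sub>m conj_mat x" by (simp add: mat_algebra)
    have "a \<cdot>\<^sub>m (v * (conj_mat v * y)) = a \<cdot>\<^sub>m (- y)"
      by (simp add: mult_mat_cancel_left[OF vc] mat_algebra)
    then have "v * conj_mat x = a \<cdot>\<^sub>m (- y)"
      unfolding * by (simp add: mat_algebra smult_smult_mat aa)
    then show ?thesis by (simp add: smult_uminus_mat)
  qed
  have Z: "mat_adjoint (hcat x y) * hcat x y = 1\<^sub>m 2"
    by (simp add: adjoint_hcat_mult_hcat xx yy xy yx del: One_nat_def)
  obtain W where [simp]: "dim_row W = m" "dim_col W = 2 * n"
    and WW: "mat_adjoint W * W = 1\<^sub>m (2 * n)" and ZW: "mat_adjoint (hcat x y) * W = 0\<^sub>m 2 (2 * n)"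
    using isometry_complement[of "hcat x y" 2 "2 * n"] Z by (auto simp: m_def)
  have WZ: "mat_adjoint W * hcat x y = 0\<^sub>m (2 * n) 2"
    using ZW by (rule adjoint_mult_zero_sym) simp
  have U: "mat_adjoint (hcat (hcat x y) W) * hcat (hcat x y) W = 1\<^sub>m m"
    by (simp add: adjoint_hcat_mult_hcat[of "hcat x y"] Z ZW WW WZ m_def)
  \<comment> \<open>A square matrix with orthonormal columns is unitary; the reversed product is the
    resolution of the identity required for the compression.\<close>
  have "hcat (hcat x y) W * mat_adjoint (hcat (hcat x y) W) = 1\<^sub>m m"
    by (rule left_inverse_imp_right_inverse[OF U]) (auto intro!: carrier_matI simp: m_def)
  then have "hcat (hcat x y) W * (conj_mat (hcat (hcat x y) W))\<^sup>T = 1\<^sub>m m" by simp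
  \<comment> \<open>Rule 7 of \<open>conj_transpose_adjoint\<close> is switched off because it would
    restore the adjoint before \<open>hcat_mult_transpose\<close> can apply.\<close>
  then have res: "x * mat_adjoint x + y * mat_adjoint y + W * mat_adjoint W = 1\<^sub>m m"
    by (simp add: conj_hcat hcat_mult_transpose del: conj_transpose_adjoint(7)) simp
  define v' where "v' = mat_adjoint W * v * conj_mat W"
  define e' where "e' = mat_adjoint W * e * conj_mat W"
  note v' = compress_antisymmetric[of v m x y W "2 * n" a, OF _ _ _ _ _ _ _ _ vT vv WW res vx vy, folded v'_def, simplified]
  have "e * conj_mat x = - (1 \<cdot>\<^sub>m y)" "e * conj_mat y = 1 \<cdot>\<^sub>m x" using ex ey by simp_all
  note e' = compress_antisymmetric[of e m x y W "2 * n" 1, OF _ _ _ _ _ _ _ _ eT ee WW res this, folded e'_def, simplified]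
  have "v' \<in> antisym_mats (2 * n)" "e' \<in> antisym_mats (2 * n)"
    using v'(1) e'(1) by (auto simp: antisym_mats_def v'_def e'_def intro!: carrier_matI)
  from Suc.IH[OF this(1) v'(2) this(2) e'(2)]
  obtain X Y d where XY: "X \<in> carrier_mat (2 * n) n" "Y \<in> carrier_mat (2 * n) n"
    "mat_adjoint X * X = 1\<^sub>m n" "mat_adjoint Y * Y = 1\<^sub>m n" "mat_adjoint X * Y = 0\<^sub>m n n"
    and d: "\<forall>i<n. d i * cnj (d i) = 1"
    and e'f: "e' = frame X Y (1\<^sub>m n)" and v'f: "v' = frame X Y (diag_of n d)" by blast
  have [simp]: "dim_row X = 2 * n" "dim_col X = n" "dim_row Y = 2 * n" "dim_col Y = n"
    using XY by auto
  have xW: "mat_adjoint x * W = 0\<^sub>m 1 (2 * n)" and yW: "mat_adjoint y * W = 0\<^sub>m 1 (2 * n)"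
    using adjoint_hcat_mult_eq_zeroD[OF ZW] by simp_all
  have Wx: "mat_adjoint W * x = 0\<^sub>m (2 * n) 1" and Wy: "mat_adjoint W * y = 0\<^sub>m (2 * n) 1"
    using xW yW by (auto intro!: adjoint_mult_zero_sym)
  note cancel = mult_mat_cancel_left[OF xW] mult_mat_cancel_left[OF yW] mult_mat_cancel_left[OF WW]
  let ?X = "hcat x (W * X)" and ?Y = "hcat y (W * Y)"
  \<comment> \<open>The identity is read as a diagonal with a prepended entry, so that
    \<open>frame_hcat\<close> serves \<open>e\<close> as well as \<open>v\<close>.\<close>
  have one: "diag_of (Suc n) (case_nat 1 (\<lambda>_. 1)) = 1\<^sub>m (Suc n)"
    by (rule eq_matI) (auto simp: diag_of_def split: nat.splits)
  show ?case
  proof (intro exI conjI)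
    show "?X \<in> carrier_mat (2 * Suc n) (Suc n)" "?Y \<in> carrier_mat (2 * Suc n) (Suc n)"
      by (auto intro!: carrier_matI simp: m_def)
    show "mat_adjoint ?X * ?X = 1\<^sub>m (Suc n)" "mat_adjoint ?Y * ?Y = 1\<^sub>m (Suc n)" 
      by (simp_all add: adjoint_hcat_mult_hcat mat_algebra cancel xx yy Wx Wy XY plus_1_eq_Suc del: One_nat_def)
    show "mat_adjoint ?X * ?Y = 0\<^sub>m (Suc n) (Suc n)"
      by (simp add: adjoint_hcat_mult_hcat mat_algebra cancel xy Wx Wy XY plus_1_eq_Suc del: One_nat_def)
    show "\<forall>i<Suc n. case_nat a d i * cnj (case_nat a d i) = 1"
      using aa d by (auto split: nat.splits)
    have "frame ?X ?Y (1\<^sub>m (Suc n)) = x * y\<^sup>T - y * x\<^sup>T + W * frame X Y (diag_of n (\<lambda>_. 1)) * W\<^sup>T"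
      unfolding one[symmetric] by (subst frame_hcat[of _ m _ _ "2 * n"]) simp_all
    then show "e = frame ?X ?Y (1\<^sub>m (Suc n))"
      using e'(3) by (simp only: e'f diag_of_one)
    show "v = frame ?X ?Y (diag_of (Suc n) (case_nat a d))"
      using v'(3) frame_hcat[of x m y W "2 * n" X n Y a d] by (simp add: v'f)
  qed
qed

subsection \<open>Chains\<close>

lemma triple_same_outer:
  assumes "dim_row b = dim_row a" "dim_col b = dim_col a"
  shows "triple a b a = a * mat_adjoint b * a"
  using assms by (intro eq_matI) (auto simp: triple_def simp del: index_mult_mat(1))

lemma sim_h_sym: "sim_h m u e \<Longrightarrow> sim_h m e u"
  by (simp add: sim_h_def)

lemma sim_h_chain_refl: "tripotent m u \<Longrightarrow> sim_h_chain m 0 u u"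
  by (auto simp: sim_h_chain_def)

lemma sim_h_chain_Suc:
  assumes "sim_h_chain m k u e" "sim_h m e f"
  shows "sim_h_chain m (Suc k) u f"
proof -
  obtain w where "w 0 = u" "w k = e" "\<forall>j\<le>k. tripotent m (w j)" "\<forall>j<k. sim_h m (w j) (w (Suc j))"
    using assms(1) unfolding sim_h_chain_def by auto
  with assms(2) show ?thesis
    unfolding sim_h_chain_def
    by (intro exI[of _ "w(Suc k := f)"]) (auto simp: le_Suc_eq less_Suc_eq sim_h_def le_h_def)
qed

lemma sim_h_chain_imp_le_ht:
  assumes "sim_h_chain m k u e"
  shows "le_ht m u e" "le_ht m e u"
proof -
  obtain w where w: "w 0 = u" "w k = e" "\<forall>j\<le>k. tripotent m (w j)" "\<forall>j<k. sim_h m (w j) (w (Suc j))"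
    using assms unfolding sim_h_chain_def by auto
  \<comment> \<open>\<open>le_ht m u e\<close> lists its tripotents from \<open>e\<close> to
    \<open>u\<close>, against the direction of the chain, so \<open>w\<close> is traversed
    backwards.\<close>
  have "le_h m (w (k - j)) (w (k - (j - 1)))" if "j \<in> {1..k}" for j
  proof -
    have "k - (j - 1) = Suc (k - j)" "k - j < k" using that by auto
    then show ?thesis using w(4) by (simp add: sim_h_def)
  qed
  then show "le_ht m u e"
    unfolding le_ht_def using w by (intro exI[of _ k] exI[of _ "\<lambda>j. w (k - j)"]) auto
  have "le_h m (w j) (w (j - 1))" if "j \<in> {1..k}" for j
  proof -
    have "j - 1 < k" "Suc (j - 1) = j" using that by auto
    then show ?thesis using w(4) by (metis sim_h_def)
  qed
  then show "le_ht m e u"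
    unfolding le_ht_def using w by (intro exI[of _ k] exI[of _ w]) auto
qed

subsection \<open>Monomial matrices\<close>

text \<open>Covers both diagonal matrices and matrices that are antidiagonal on two coordinates;
  products then reduce to composing index maps.\<close>

definition monomial_mat :: "nat \<Rightarrow> (nat \<Rightarrow> nat) \<Rightarrow> (nat \<Rightarrow> complex) \<Rightarrow> complex mat" where
  "monomial_mat n \<pi> g = mat n n (\<lambda>(i,j). if j = \<pi> i then g i else 0)"

lemma dim_monomial_mat [simp]: "dim_row (monomial_mat n \<pi> g) = n" "dim_col (monomial_mat n \<pi> g) = n"
  by (auto simp: monomial_mat_def)

lemma diag_of_eq_monomial_mat: "diag_of n d = monomial_mat n id d"
  by (simp add: diag_of_def monomial_mat_def)

lemma monomial_mat_cong:
  "(\<And>i. i < n \<Longrightarrow> \<pi> i = \<rho> i \<and> g i = h i) \<Longrightarrow> monomial_mat n \<pi> g = monomial_mat n \<rho> h"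
  by (rule eq_matI) (auto simp: monomial_mat_def)

lemma monomial_mat_mult:
  assumes "\<And>i. i < n \<Longrightarrow> \<pi> i < n"
  shows "monomial_mat n \<pi> g * monomial_mat n \<rho> h = monomial_mat n (\<rho> \<circ> \<pi>) (\<lambda>i. g i * h (\<pi> i))"
proof (rule eq_matI)
  fix i j assume "i < dim_row (monomial_mat n (\<rho> \<circ> \<pi>) (\<lambda>i. g i * h (\<pi> i)))"
    "j < dim_col (monomial_mat n (\<rho> \<circ> \<pi>) (\<lambda>i. g i * h (\<pi> i)))"
  then have ij: "i < n" "j < n" by simp_all
  then show "(monomial_mat n \<pi> g * monomial_mat n \<rho> h) $$ (i,j)
      = monomial_mat n (\<rho> \<circ> \<pi>) (\<lambda>i. g i * h (\<pi> i)) $$ (i,j)"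
    using assms
    by (simp add: monomial_mat_def scalar_prod_def if_distrib[of "\<lambda>x. x * _"] cong: if_cong)
qed simp_all

text \<open>Transposition inverts the index map, and an involution is its own inverse.\<close>

lemma transpose_monomial_mat:
  assumes "\<And>i. i < n \<Longrightarrow> \<pi> i < n" "\<And>i. i < n \<Longrightarrow> \<pi> (\<pi> i) = i"
  shows "(monomial_mat n \<pi> g)\<^sup>T = monomial_mat n \<pi> (\<lambda>i. g (\<pi> i))"
proof (rule eq_matI)
  fix i j assume "i < dim_row (monomial_mat n \<pi> (\<lambda>i. g (\<pi> i)))"
    "j < dim_col (monomial_mat n \<pi> (\<lambda>i. g (\<pi> i)))"
  then have ij: "i < n" "j < n" by simp_all
  show "(monomial_mat n \<pi> g)\<^sup>T $$ (i,j) = monomial_mat n \<pi> (\<lambda>i. g (\<pi> i)) $$ (i,j)"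
  proof (cases "j = \<pi> i")
    case True
    then show ?thesis using ij assms(2)[of i] by (simp add: monomial_mat_def)
  next
    case False
    then have "i \<noteq> \<pi> j" using assms(2) ij by metis
    with False show ?thesis using ij by (simp add: monomial_mat_def)
  qed
qed simp_all

lemma adjoint_monomial_mat:
  assumes "\<And>i. i < n \<Longrightarrow> \<pi> i < n" "\<And>i. i < n \<Longrightarrow> \<pi> (\<pi> i) = i"
  shows "mat_adjoint (monomial_mat n \<pi> g) = monomial_mat n \<pi> (\<lambda>i. cnj (g (\<pi> i)))"
proof -
  have "mat_adjoint (monomial_mat n \<pi> g) = conj_mat ((monomial_mat n \<pi> g)\<^sup>T)" by simp
  also have "\<dots> = conj_mat (monomial_mat n \<pi> (\<lambda>i. g (\<pi> i)))"
    using transpose_monomial_mat[of n \<pi> g] assms by simp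
  also have "\<dots> = monomial_mat n \<pi> (\<lambda>i. cnj (g (\<pi> i)))"
    by (rule eq_matI) (auto simp: monomial_mat_def)
  finally show ?thesis .
qed

subsection \<open>Tripotents built from an isotropic frame\<close>

lemma unimodular_iff: "a * cnj a = 1 \<longleftrightarrow> cmod a = 1"
proof -
  have "a * cnj a = complex_of_real ((cmod a)\<^sup>2)" by (simp add: complex_norm_square del: of_real_power)
  then have "a * cnj a = 1 \<longleftrightarrow> (cmod a)\<^sup>2 = 1" by (metis of_real_eq_1_iff)
  then show ?thesis by (simp add: power2_eq_1_iff) (use norm_ge_zero[of a] in linarith)
qed

text \<open>The columns of \<open>X\<close> and \<open>Y\<close> together are orthonormal; when m =
  2n they form a unitary matrix, the case treated in \<open>det_frame\<close>.\<close>

locale isotropic_frame =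
  fixes X Y :: "complex mat" and m n :: nat
  assumes dims [simp]: "dim_row X = m" "dim_col X = n" "dim_row Y = m" "dim_col Y = n"
    and XX: "mat_adjoint X * X = 1\<^sub>m n" and YY: "mat_adjoint Y * Y = 1\<^sub>m n"
    and XY: "mat_adjoint X * Y = 0\<^sub>m n n"
begin

lemma YX: "mat_adjoint Y * X = 0\<^sub>m n n"
  using XY by (rule adjoint_mult_zero_sym) simp

lemma frame_relations_transposed:
  "X\<^sup>T * conj_mat X = 1\<^sub>m n" "Y\<^sup>T * conj_mat Y = 1\<^sub>m n"
  "X\<^sup>T * conj_mat Y = 0\<^sub>m n n" "Y\<^sup>T * conj_mat X = 0\<^sub>m n n"
  using arg_cong[OF XX, of conj_mat] arg_cong[OF YY, of conj_mat]
    arg_cong[OF XY, of conj_mat] arg_cong[OF YX, of conj_mat]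
  by (simp_all add: mat_algebra)

lemmas relations = XX YY XY YX frame_relations_transposed
lemmas cancels = relations[THEN mult_mat_cancel_left]

lemma dim_frame [simp]: "dim_row (frame X Y S) = m" "dim_col (frame X Y S) = m"
  by (simp_all add: frame_def)

text \<open>The cross terms contain \<open>Y\<^sup>T * conj_mat X\<close> or
  \<open>X\<^sup>T * conj_mat Y\<close>, which vanish by orthogonality of the ranges.\<close>

lemma frame_mult_adjoint:
  assumes [simp]: "dim_row S = n" "dim_col S = n" "dim_row T = n" "dim_col T = n"
  shows "frame X Y S * mat_adjoint (frame X Y T)
    = X * (S * (mat_adjoint T * mat_adjoint X)) + Y * (S * (mat_adjoint T * mat_adjoint Y))"
  unfolding frame_def by (simp add: mat_algebra cancels) (rule eq_matI; simp del: index_mult_mat(1))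

text \<open>Because of this, relations between tripotents in a common frame can be checked on their
  n-by-n parameters.\<close>

lemma frame_triple:
  assumes [simp]: "dim_row S = n" "dim_col S = n" "dim_row T = n" "dim_col T = n"
      "dim_row R = n" "dim_col R = n"
  shows "frame X Y S * mat_adjoint (frame X Y T) * frame X Y R = frame X Y (S * mat_adjoint T * R)"
  unfolding frame_mult_adjoint[OF assms(1-4)] unfolding frame_def
  by (simp add: mat_algebra cancels)

text \<open>A left inverse of the frame map: equal frames have equal parameters.\<close>

lemma adjoint_frame_conj:
  assumes [simp]: "dim_row S = n" "dim_col S = n"
  shows "mat_adjoint X * frame X Y S * conj_mat Y = S"
  unfolding frame_def by (simp add: mat_algebra cancels relations)

lemma tripotent_frame:
  assumes [simp]: "dim_row S = n" "dim_col S = n" and "S\<^sup>T = S" "S * mat_adjoint S = 1\<^sub>m n"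
  shows "tripotent m (frame X Y S)"
proof -
  have 1: "(frame X Y S)\<^sup>T = - frame X Y S"
    unfolding frame_def using assms(3)
    by (simp add: mat_algebra) (rule eq_matI; simp del: index_mult_mat(1))
  have 2: "S * mat_adjoint S * S = S"
    unfolding assms(4) by (simp add: mult_mat_trivial)
  have 3: "triple (frame X Y S) (frame X Y S) (frame X Y S) = frame X Y (S * mat_adjoint S * S)"
    by (simp add: triple_same_outer frame_triple)
  have 4: "frame X Y S \<in> carrier_mat m m" by (rule carrier_matI) simp_all
  show ?thesis
    unfolding tripotent_def antisym_mats_def using 1 4 3[unfolded 2] by blast
qed

text \<open>As \<open>S * mat_adjoint T\<close> is Hermitian, \<open>S * mat_adjoint T * S\<close>
  becomes \<open>T * mat_adjoint S * S\<close>, which is \<open>T\<close> by unitarity; the same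
  holds with the roles exchanged.\<close>

lemma sim_h_frame:
  assumes S [simp]: "dim_row S = n" "dim_col S = n" and S': "S\<^sup>T = S" "S * mat_adjoint S = 1\<^sub>m n"
    and T [simp]: "dim_row T = n" "dim_col T = n" and T': "T\<^sup>T = T" "T * mat_adjoint T = 1\<^sub>m n"
    and ST: "S * mat_adjoint T = T * mat_adjoint S"
  shows "sim_h m (frame X Y S) (frame X Y T)"
proof -
  have SS: "mat_adjoint S * S = 1\<^sub>m n" and TT: "mat_adjoint T * T = 1\<^sub>m n"
    using left_inverse_imp_right_inverse[OF S'(2)] left_inverse_imp_right_inverse[OF T'(2)]
    by (simp_all add: carrier_matI)
  have "S * mat_adjoint T * S = T" unfolding ST by (simp add: mat_algebra SS)
  moreover have "T * mat_adjoint S * T = S" unfolding ST[symmetric] by (simp add: mat_algebra TT)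
  ultimately show ?thesis
    using tripotent_frame[OF S S'] tripotent_frame[OF T T']
    by (simp add: sim_h_def le_h_def triple_same_outer frame_triple)
qed

text \<open>With the unitary U = \<open>hcat X Y\<close>, the frame of \<open>D\<close> is U diag(D,
  D) U^* times the frame of the identity, and the first factor has determinant (det D)^2.\<close>

lemma det_frame:
  assumes [simp]: "dim_row D = n" "dim_col D = n" and m: "m = 2 * n"
  shows "det (frame X Y D) = (det D)\<^sup>2 * det (frame X Y (1\<^sub>m n))"
proof -
  define U where "U = hcat X Y"
  define F where "F = four_block_mat D (0\<^sub>m n n) (0\<^sub>m n n) D"
  have U [simp]: "U \<in> carrier_mat m m" "mat_adjoint U \<in> carrier_mat m m" and F [simp]: "F \<in> carrier_mat m m"
    unfolding U_def F_def by (rule carrier_matI; simp add: m)+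
  have G [simp]: "U * F \<in> carrier_mat m m" "U * F * mat_adjoint U \<in> carrier_mat m m"
    using mult_carrier_mat[OF U(1) F] mult_carrier_mat[OF mult_carrier_mat[OF U(1) F] U(2)] by simp_all
  have fr: "frame X Y (1\<^sub>m n) \<in> carrier_mat m m" by (rule carrier_matI) simp_all
  have D: "D \<in> carrier_mat n n" by (rule carrier_matI) simp_all
  have "det F = det D * det D"
    unfolding F_def by (rule det_four_block_mat_lower_left_zero[OF D _ _ D]) simp_all
  moreover have "det (mat_adjoint U) * det U = 1"
  proof -
    have "mat_adjoint U * U = 1\<^sub>m m"
      by (simp add: U_def adjoint_hcat_mult_hcat relations m mult_2)
    then show ?thesis using det_mult[OF U(2,1)] by simp
  qed
  moreover have "det (U * F * mat_adjoint U) = det U * det F * det (mat_adjoint U)"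
    by (simp add: det_mult[OF G(1) U(2)] det_mult[OF U(1) F])
  ultimately have det: "det (U * F * mat_adjoint U) = (det D)\<^sup>2"
    by (simp add: power2_eq_square algebra_simps)
  have "U * F * mat_adjoint U = hcat (X * D) (Y * D) * (conj_mat U)\<^sup>T"
    using hcat_mult_four_block_diag[of X Y D D] by (simp add: U_def F_def)
  also have "\<dots> = X * D * mat_adjoint X + Y * D * mat_adjoint Y"
    by (simp add: U_def conj_hcat hcat_mult_transpose del: conj_transpose_adjoint(7)) simp
  finally have UFU: "U * F * mat_adjoint U = X * D * mat_adjoint X + Y * D * mat_adjoint Y" .
  have "U * F * mat_adjoint U * frame X Y (1\<^sub>m n) = frame X Y D"
    unfolding UFU frame_def
    by (simp add: mat_algebra cancels)
  moreover have "det (U * F * mat_adjoint U * frame X Y (1\<^sub>m n))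
      = det (U * F * mat_adjoint U) * det (frame X Y (1\<^sub>m n))"
    by (rule det_mult[OF G(2) fr])
  ultimately show ?thesis using det by simp
qed

text \<open>The second parameter swaps coordinates \<open>p\<close> and \<open>q\<close> with both
  entries equal to \<open>c\<close>, hence is symmetric. The condition on \<open>c\<close> is what
  makes its product with the adjoint diagonal Hermitian.\<close>

lemma sim_h_frame_merge:
  assumes "p < n" "q < n" "p \<noteq> q" and d: "\<And>i. i < n \<Longrightarrow> d i * cnj (d i) = 1"
    and c: "c * cnj c = 1" "d p * d q = c * c"
  shows "sim_h m (frame X Y (diag_of n d))
    (frame X Y (monomial_mat n (id(p := q, q := p)) (\<lambda>i. if i = p \<or> i = q then c else d i)))"
proof -
  define \<pi> where "\<pi> = id(p := q, q := p)"
  define g where "g = (\<lambda>i. if i = p \<or> i = q then c else d i)"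
  have \<pi>: "\<pi> i < n" "\<pi> (\<pi> i) = i" if "i < n" for i
    using assms(1-3) that by (auto simp: \<pi>_def)
  have g\<pi>: "g (\<pi> i) = g i" for i using assms(3) by (auto simp: g_def \<pi>_def)
  have gg: "g i * cnj (g i) = 1" if "i < n" for i using that c(1) d by (simp add: g_def)
  have gT: "(monomial_mat n \<pi> g)\<^sup>T = monomial_mat n \<pi> g"
    using transpose_monomial_mat[of n \<pi> g] \<pi> by (simp add: g\<pi>)
  have ga: "mat_adjoint (monomial_mat n \<pi> g) = monomial_mat n \<pi> (\<lambda>i. cnj (g i))"
    using adjoint_monomial_mat[of n \<pi> g] \<pi> by (simp add: g\<pi>)
  have da: "mat_adjoint (monomial_mat n id d) = monomial_mat n id (\<lambda>i. cnj (d i))"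
    using adjoint_monomial_mat[of n id d] by simp
  \<comment> \<open>Both identities are \<open>d p * d q = c * c\<close> divided by unimodular
    numbers; they are the Hermitian condition at the entries \<open>p\<close> and
    \<open>q\<close>.\<close>
  have pq: "d p * cnj c = c * cnj (d q)" "d q * cnj c = c * cnj (d p)"
  proof -
    have "d p * cnj c = (d p * d q) * cnj c * cnj (d q)" using d[OF \<open>q < n\<close>] by (simp add: algebra_simps)
    also have "\<dots> = c * cnj (d q) * (c * cnj c)" by (simp add: c(2) algebra_simps)
    finally show "d p * cnj c = c * cnj (d q)" using c(1) by simp
    have "d q * cnj c = (d p * d q) * cnj c * cnj (d p)" using d[OF \<open>p < n\<close>] by (simp add: algebra_simps)
    also have "\<dots> = c * cnj (d p) * (c * cnj c)" by (simp add: c(2) algebra_simps)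
    finally show "d q * cnj c = c * cnj (d p)" using c(1) by simp
  qed
  show ?thesis
    unfolding diag_of_eq_monomial_mat g_def[symmetric] \<pi>_def[symmetric]
  proof (rule sim_h_frame)
    show "(monomial_mat n id d)\<^sup>T = monomial_mat n id d"
      using transpose_diag_of[of n d] by (simp add: diag_of_eq_monomial_mat)
    show "monomial_mat n id d * mat_adjoint (monomial_mat n id d) = 1\<^sub>m n"
      unfolding da diag_of_one[symmetric] diag_of_eq_monomial_mat
      by (subst monomial_mat_mult) (auto simp: d intro!: monomial_mat_cong)
    show "monomial_mat n \<pi> g * mat_adjoint (monomial_mat n \<pi> g) = 1\<^sub>m n"
      unfolding ga diag_of_one[symmetric] diag_of_eq_monomial_mat
      by (subst monomial_mat_mult[OF \<pi>(1)]) (auto simp: \<pi> g\<pi> gg intro!: monomial_mat_cong)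
    show "monomial_mat n id d * mat_adjoint (monomial_mat n \<pi> g) =
        monomial_mat n \<pi> g * mat_adjoint (monomial_mat n id d)"
    proof -
      have "d i * cnj (g i) = g i * cnj (d (\<pi> i))" if "i < n" for i
        using \<open>p \<noteq> q\<close> pq by (auto simp: g_def \<pi>_def)
      then show ?thesis
        unfolding ga da by (simp add: monomial_mat_mult \<pi>) (rule monomial_mat_cong, simp)
    qed
  qed (simp_all add: gT)
qed

text \<open>The merged matrix depends on the entries at \<open>p\<close> and \<open>q\<close> only
  through a square root of their product, so both diagonals are related to one common intermediate
  tripotent.\<close>

lemma sim_h_frame_diag_step:
  assumes "p < n" "q < n" "p \<noteq> q"
    and d: "\<And>i. i < n \<Longrightarrow> d i * cnj (d i) = 1" and f: "\<And>i. i < n \<Longrightarrow> f i * cnj (f i) = 1"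
    and eq: "d p * d q = f p * f q" "\<And>i. i \<noteq> p \<Longrightarrow> i \<noteq> q \<Longrightarrow> d i = f i"
  shows "\<exists>u. sim_h m (frame X Y (diag_of n d)) u \<and> sim_h m u (frame X Y (diag_of n f))"
proof -
  define c where "c = csqrt (d p * d q)"
  have cc: "d p * d q = c * c" by (simp add: c_def flip: power2_eq_square)
  have "cmod (d p) = 1" "cmod (d q) = 1" using d assms(1,2) by (auto simp flip: unimodular_iff)
  then have "c * cnj c = 1" by (simp add: c_def unimodular_iff norm_mult)
  moreover have "(\<lambda>i. if i = p \<or> i = q then c else d i) = (\<lambda>i. if i = p \<or> i = q then c else f i)"
    using eq(2) by auto
  moreover have "f p * f q = c * c" using cc eq(1) by simp
  ultimately show ?thesis
    using sim_h_frame_merge[of p q d c] sim_h_frame_merge[of p q f c] assms cc sim_h_sym by auto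
qed

lemma tripotent_frame_diag:
  assumes "\<And>i. i < n \<Longrightarrow> d i * cnj (d i) = 1"
  shows "tripotent m (frame X Y (diag_of n d))"
proof (rule tripotent_frame)
  show "diag_of n d * mat_adjoint (diag_of n d) = 1\<^sub>m n"
    by (rule eq_matI) (use assms in \<open>auto simp: adjoint_diag_of index_mult_diag_of simp del: index_mult_mat(1)\<close>,
        auto simp: diag_of_def assms)
qed (simp_all add: transpose_diag_of)

text \<open>Each induction step leaves 1 at position \<open>k\<close> and moves the accumulated
  product to \<open>Suc k\<close>, at the cost of two relations.\<close>

lemma sim_h_chain_collect:
  assumes d: "\<And>i. i < n \<Longrightarrow> d i * cnj (d i) = 1" and "k < n"
  shows "sim_h_chain m (2 * k) (frame X Y (diag_of n d))
    (frame X Y (diag_of n (\<lambda>i. if i < k then 1 else if i = k then \<Prod>j\<le>k. d j else d i)))"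
  using \<open>k < n\<close>
proof (induction k)
  case 0
  have "(\<lambda>i. if i < 0 then 1 else if i = 0 then \<Prod>j\<le>0. d j else d i) = d" by auto
  then show ?case using sim_h_chain_refl[OF tripotent_frame_diag[OF d]] by simp
next
  case (Suc k)
  define f where "f k = (\<lambda>i. if i < k then 1 else if i = k then \<Prod>j\<le>k. d j else d i)" for k
  have "cmod (\<Prod>j\<le>k. d j) = 1" if "k < n" for k
    using d that by (auto simp: unimodular_iff simp flip: prod_norm intro!: prod.neutral)
  then have f: "f k i * cnj (f k i) = 1" if "k < n" "i < n" for k i
    using that d by (auto simp: f_def unimodular_iff)
  obtain u where "sim_h m (frame X Y (diag_of n (f k))) u" "sim_h m u (frame X Y (diag_of n (f (Suc k))))"
  proof -
    have "f k k * f k (Suc k) = f (Suc k) k * f (Suc k) (Suc k)" by (simp add: f_def)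
    moreover have "f k i = f (Suc k) i" if "i \<noteq> k" "i \<noteq> Suc k" for i using that by (simp add: f_def)
    ultimately show thesis
      using sim_h_frame_diag_step[of k "Suc k" "f k" "f (Suc k)"] f Suc.prems that by auto
  qed
  moreover have "sim_h_chain m (2 * k) (frame X Y (diag_of n d)) (frame X Y (diag_of n (f k)))"
    using Suc by (simp add: f_def)
  ultimately have "sim_h_chain m (Suc (Suc (2 * k))) (frame X Y (diag_of n d)) (frame X Y (diag_of n (f (Suc k))))"
    using sim_h_chain_Suc by blast
  then show ?case by (simp add: f_def)
qed

lemma sim_h_chain_frame:
  assumes d: "\<And>i. i < n \<Longrightarrow> d i * cnj (d i) = 1" and "(\<Prod>i<n. d i)\<^sup>2 = 1" and "n > 0"
  shows "sim_h_chain m (2 * n - 1) (frame X Y (diag_of n d)) (frame X Y (1\<^sub>m n))"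
proof -
  \<comment> \<open>The product is collected at the last index \<open>l\<close>; the length
    \<open>2 * n - 1\<close> is then \<open>2 * l\<close> collecting steps plus one step from a
    diagonal of signs, a Hermitian involution, to the identity.\<close>
  obtain l where n: "n = Suc l" using \<open>n > 0\<close> gr0_implies_Suc by blast
  define P where "P = (\<Prod>j\<le>l. d j)"
  define f where "f = (\<lambda>i. if i < l then 1 else if i = l then P else d i)"
  have "P\<^sup>2 = 1" using assms(2) by (simp add: P_def n lessThan_Suc_atMost)
  then have P: "P = 1 \<or> P = -1" by (simp add: power2_eq_1_iff)
  have fr: "cnj (f i) = f i" "f i * f i = 1" if "i < n" for i
    using that P by (auto simp: f_def n)
  have chain: "sim_h_chain m (2 * l) (frame X Y (diag_of n d)) (frame X Y (diag_of n f))"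
    unfolding f_def P_def by (rule sim_h_chain_collect[OF d]) (simp_all add: n)
  have adj: "mat_adjoint (diag_of n f) = diag_of n f"
    by (rule eq_matI) (use fr in \<open>auto simp: diag_of_def\<close>)
  have sq: "diag_of n f * diag_of n f = 1\<^sub>m n"
    by (rule eq_matI) (use fr in \<open>auto simp: index_mult_diag_of simp del: index_mult_mat(1)\<close>,
        auto simp: diag_of_def fr)
  have "sim_h m (frame X Y (diag_of n f)) (frame X Y (1\<^sub>m n))"
    by (rule sim_h_frame) (simp_all add: transpose_diag_of adj sq mat_algebra)
  from sim_h_chain_Suc[OF chain this] show ?thesis by (simp add: n)
qed

end

subsection \<open>Unitary tripotents\<close>

lemma antisym_mats_dim:
  "e \<in> antisym_mats m \<Longrightarrow> dim_row e = m \<and> dim_col e = m"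
  by (auto simp: antisym_mats_def)

lemma add_eq_double_mat:
  fixes A :: "complex mat"
  assumes "A + B = 2 \<cdot>\<^sub>m A" "dim_row A = dim_row B" "dim_col A = dim_col B"
  shows "B = A"
proof (rule eq_matI)
  fix i j assume "i < dim_row A" "j < dim_col A"
  then show "B $$ (i,j) = A $$ (i,j)"
    using arg_cong[OF assms(1), of "\<lambda>a. a $$ (i,j)"] assms(2,3) by simp
qed (use assms in auto)

lemma tripotentD:
  assumes "tripotent m e"
  shows "e \<in> antisym_mats m" "e * mat_adjoint e * e = e"
  using assms triple_same_outer[of e e] by (auto simp: tripotent_def)

text \<open>With the projections \<open>p\<close> and \<open>q\<close> the condition reads px + xq =
  2x, which forces px = x for every antisymmetric \<open>x\<close>. Testing this on elementary
  antisymmetric matrices identifies every column of \<open>p\<close>.\<close>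

lemma unitary_tripotent_imp_unitary:
  assumes "unitary_tripotent m e" "m \<ge> 2"
  shows "e * mat_adjoint e = 1\<^sub>m m"
proof -
  have te: "tripotent m e" using assms by (simp add: unitary_tripotent_def)
  note e = tripotentD[OF te]
  have [simp]: "dim_row e = m" "dim_col e = m" using antisym_mats_dim[OF e(1)] by auto
  define p where "p = e * mat_adjoint e"
  define q where "q = mat_adjoint e * e"
  have [simp]: "dim_row p = m" "dim_col p = m" "dim_row q = m" "dim_col q = m"
    by (simp_all add: p_def q_def)
  have e1: "e * (mat_adjoint e * e) = e" using e(2) by (simp add: mult_mat_assoc)
  have pp: "p * p = p" "q * q = q"
    using arg_cong[OF e1, of "\<lambda>a. a * mat_adjoint e"] arg_cong[OF e1, of "\<lambda>a. mat_adjoint e * a"]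
    by (simp_all add: p_def q_def mat_algebra)
  have px: "p * x = x" if x: "x \<in> antisym_mats m" for x
  proof -
    have [simp]: "dim_row x = m" "dim_col x = m" using antisym_mats_dim[OF x] by auto
    have "triple e e x = x" using assms(1) x by (simp add: unitary_tripotent_def)
    then have "2 \<cdot>\<^sub>m triple e e x = 2 \<cdot>\<^sub>m x" by simp
    then have *: "p * x + x * q = 2 \<cdot>\<^sub>m x"
      by (simp add: triple_def p_def q_def smult_smult_mat mult_mat_assoc)
    have "p * x + p * (x * q) = 2 \<cdot>\<^sub>m (p * x)"
      using arg_cong[OF *, of "\<lambda>a. p * a"] by (simp add: mat_algebra mult_mat_cancel_left[OF pp(1)])
    then have 1: "p * (x * q) = p * x" by (rule add_eq_double_mat) simp_all
    have "p * (x * q) + x * q = 2 \<cdot>\<^sub>m (x * q)"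
      using arg_cong[OF *, of "\<lambda>a. a * q"] by (simp add: mat_algebra pp)
    then have "x * q + p * (x * q) = 2 \<cdot>\<^sub>m (x * q)" by (simp add: comm_add_mat[of "x * q" m m] carrier_matI)
    then have 2: "p * (x * q) = x * q" by (rule add_eq_double_mat) simp_all
    \<comment> \<open>Both \<open>p * x\<close> and \<open>x * q\<close> equal
      \<open>p * (x * q)\<close>, so the starting equation turns into 2px = 2x.\<close>
    show ?thesis
    proof (rule eq_matI)
      fix i j assume "i < dim_row x" "j < dim_col x"
      then show "(p * x) $$ (i,j) = x $$ (i,j)"
        using arg_cong[OF *[folded trans[OF 1[symmetric] 2]], of "\<lambda>a. a $$ (i,j)"]
        by (simp del: index_mult_mat(1))
    qed simp_all
  qed
  show ?thesis
    unfolding p_def[symmetric]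
  proof (rule eq_matI)
    fix k i assume "k < dim_row (1\<^sub>m m)" "i < dim_col (1\<^sub>m m)"
    then have ki: "k < m" "i < m" by simp_all
    \<comment> \<open>Any index different from \<open>i\<close> will do, and
      \<open>m \<ge> 2\<close> provides one; column \<open>j\<close> of the test matrix
      \<open>x\<close> is then the \<open>i\<close>-th unit vector.\<close>
    define j where "j = (if i = 0 then 1 else 0 :: nat)"
    have j: "j < m" "j \<noteq> i" using assms(2) by (auto simp: j_def)
    define x where "x = mat m m (\<lambda>(a,b). if a = i \<and> b = j then 1 else if a = j \<and> b = i then -1 else 0 :: complex)"
    have "x \<in> antisym_mats m" using j by (auto simp: antisym_mats_def x_def intro!: eq_matI)
    from px[OF this] have "(p * x) $$ (k,j) = x $$ (k,j)" by simp
    moreover have xj: "x $$ (l,j) = (if l = i then 1 else 0)" if "l < m" for l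
      using that j by (simp add: x_def)
    moreover have "dim_row x = m" "dim_col x = m" by (simp_all add: x_def)
    then have "(p * x) $$ (k,j) = (\<Sum>l = 0..<m. p $$ (k,l) * x $$ (l,j))"
      using ki j by (simp add: scalar_prod_def)
    then have "(p * x) $$ (k,j) = (\<Sum>l = 0..<m. if l = i then p $$ (k,l) else 0)"
      using xj by (simp add: if_distrib[of "\<lambda>x. _ * x"] cong: if_cong)
    ultimately show "p $$ (k,i) = 1\<^sub>m m $$ (k,i)"
      using ki by simp
  qed simp_all
qed

text \<open>From u = e u^* e and unitarity of \<open>u\<close>, \<open>e\<close> has a right
  inverse; multiplying e e^* e = e by it gives the claim. This handles the intermediate tripotents
  of \<open>le_ht\<close>, which need not be unitary by definition.\<close>

lemma le_h_unitary_imp_unitary: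
  assumes "le_h m u e" "u * mat_adjoint u = 1\<^sub>m m"
  shows "e * mat_adjoint e = 1\<^sub>m m"
proof -
  have tu: "tripotent m u" and te: "tripotent m e" and ue: "u = triple e u e"
    using assms(1) by (auto simp: le_h_def)
  note e = tripotentD[OF te]
  have [simp]: "dim_row e = m" "dim_col e = m" "dim_row u = m" "dim_col u = m"
    using antisym_mats_dim tripotentD(1) tu te by auto
  have "u = e * (mat_adjoint u * e)" using ue by (simp add: triple_same_outer mult_mat_assoc)
  then have b: "e * (mat_adjoint u * e * mat_adjoint u) = 1\<^sub>m m"
    using assms(2) by (metis (no_types, lifting) dim_mat_adjoint \<open>dim_row u = m\<close> \<open>dim_col u = m\<close>
        \<open>dim_row e = m\<close> \<open>dim_col e = m\<close> index_mult_mat(2,3) mult_mat_assoc)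
  have "e * mat_adjoint e = e * mat_adjoint e * (e * (mat_adjoint u * e * mat_adjoint u))"
    unfolding b by (simp add: mult_mat_trivial)
  also have "\<dots> = (e * mat_adjoint e * e) * (mat_adjoint u * e * mat_adjoint u)"
    by (simp add: mult_mat_assoc)
  also have "\<dots> = 1\<^sub>m m" unfolding e(2) by (rule b)
  finally show ?thesis .
qed

section \<open>The determinant as a complete invariant\<close>

lemma isotropic_frame_pair:
  assumes "tripotent (2 * n) v" "v * mat_adjoint v = 1\<^sub>m (2 * n)"
    and "tripotent (2 * n) e" "e * mat_adjoint e = 1\<^sub>m (2 * n)"
  obtains X Y d where "isotropic_frame X Y (2 * n) n" "\<forall>i<n. d i * cnj (d i) = 1"
    "e = frame X Y (1\<^sub>m n)" "v = frame X Y (diag_of n d)" "det v = (\<Prod>i<n. d i)\<^sup>2 * det e"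
proof -
  obtain X Y d where XY: "X \<in> carrier_mat (2 * n) n" "Y \<in> carrier_mat (2 * n) n"
    "mat_adjoint X * X = 1\<^sub>m n" "mat_adjoint Y * Y = 1\<^sub>m n" "mat_adjoint X * Y = 0\<^sub>m n n"
    and d: "\<forall>i<n. d i * cnj (d i) = 1" and ev: "e = frame X Y (1\<^sub>m n)" "v = frame X Y (diag_of n d)"
    using antisymmetric_unitary_pair_frame[OF tripotentD(1)[OF assms(1)] assms(2)
        tripotentD(1)[OF assms(3)] assms(4)] by blast
  interpret isotropic_frame X Y "2 * n" n
    using XY by unfold_locales auto
  have det: "det v = (\<Prod>i<n. d i)\<^sup>2 * det e"
    unfolding ev by (simp add: det_frame[of "diag_of n d"] det_diag_of)
  show thesis
    by (rule that[OF isotropic_frame_axioms d ev det])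
qed

text \<open>In the joint frame \<open>triple e v e\<close> conjugates the diagonal of
  \<open>v\<close>, so its unimodular entries are real, hence signs.\<close>

lemma le_h_unitary_imp_det_eq:
  assumes "le_h (2 * n) v e" "v * mat_adjoint v = 1\<^sub>m (2 * n)"
  shows "det v = det e"
proof -
  have tv: "tripotent (2 * n) v" and te: "tripotent (2 * n) e" and ve: "v = triple e v e"
    using assms(1) by (auto simp: le_h_def)
  obtain X Y d where fr: "isotropic_frame X Y (2 * n) n" and d: "\<forall>i<n. d i * cnj (d i) = 1"
    and ev: "e = frame X Y (1\<^sub>m n)" "v = frame X Y (diag_of n d)"
    and det: "det v = (\<Prod>i<n. d i)\<^sup>2 * det e"
    by (rule isotropic_frame_pair[OF tv assms(2) te le_h_unitary_imp_unitary[OF assms]])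
  interpret isotropic_frame X Y "2 * n" n by (rule fr)
  have "triple e v e = frame X Y (diag_of n (\<lambda>i. cnj (d i)))"
    unfolding ev by (simp add: triple_same_outer frame_triple adjoint_diag_of mult_mat_trivial)
  then have ev': "v = frame X Y (diag_of n (\<lambda>i. cnj (d i)))" using ve by (rule trans[rotated])
  have "diag_of n d = mat_adjoint X * v * conj_mat Y"
    unfolding ev(2) by (simp add: adjoint_frame_conj)
  also have "\<dots> = diag_of n (\<lambda>i. cnj (d i))"
    unfolding ev' by (simp add: adjoint_frame_conj)
  finally have eq: "diag_of n d = diag_of n (\<lambda>i. cnj (d i))" .
  have "d i * d i = 1" if "i < n" for i
  proof -
    have "cnj (d i) = d i"
      using arg_cong[OF eq, of "\<lambda>a. a $$ (i,i)"] that by (simp add: diag_of_def)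
    then show ?thesis using d that by metis
  qed
  then have "(\<Prod>i<n. d i)\<^sup>2 = 1" by (simp add: power2_eq_square flip: prod.distrib)
  then show ?thesis using det by simp
qed

lemma le_ht_unitary_imp_det_eq:
  assumes "le_ht (2 * n) v e" "v * mat_adjoint v = 1\<^sub>m (2 * n)"
  shows "det v = det e"
proof -
  obtain k :: nat and w where w: "w 0 = e" "w k = v" "\<forall>j\<in>{1..k}. le_h (2 * n) (w j) (w (j - 1))"
    using assms(1) unfolding le_ht_def by blast
  \<comment> \<open>The induction starts at the unitary end \<open>w k = v\<close> and climbs to
    \<open>e\<close>, because unitarity is passed from the smaller tripotent to the larger
    one.\<close>
  have "w (k - i) * mat_adjoint (w (k - i)) = 1\<^sub>m (2 * n) \<and> det (w (k - i)) = det v" if "i \<le> k" for i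
    using that
  proof (induction i)
    case 0
    then show ?case using w assms by simp
  next
    case (Suc i)
    then have "k - i \<in> {1..k}" "k - i - 1 = k - Suc i" by auto
    then have "le_h (2 * n) (w (k - i)) (w (k - Suc i))" using w(3) by metis
    then show ?case
      using Suc le_h_unitary_imp_unitary le_h_unitary_imp_det_eq by (metis Suc_leD)
  qed
  from this[of k] show ?thesis using w by simp
qed

theorem proposition5p18:
  fixes n :: nat and v e :: "complex mat"
  assumes "n \<ge> 2"
    and "unitary_tripotent (2 * n) v"
    and "unitary_tripotent (2 * n) e"
  shows "(sim_ht (2 * n) v e \<longleftrightarrow> det v = det e) \<and>
    (sim_ht (2 * n) v e \<longrightarrow> (\<exists>k \<le> 2 * n - 1. sim_h_chain (2 * n) k v e))"
proof -
  have tv: "tripotent (2 * n) v" and te: "tripotent (2 * n) e"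
    using assms by (auto simp: unitary_tripotent_def)
  have vv: "v * mat_adjoint v = 1\<^sub>m (2 * n)" and ee: "e * mat_adjoint e = 1\<^sub>m (2 * n)"
    using assms by (auto intro!: unitary_tripotent_imp_unitary)
  obtain X Y d where fr: "isotropic_frame X Y (2 * n) n" and d: "\<forall>i<n. d i * cnj (d i) = 1"
    and ev: "e = frame X Y (1\<^sub>m n)" "v = frame X Y (diag_of n d)"
    and det: "det v = (\<Prod>i<n. d i)\<^sup>2 * det e"
    by (rule isotropic_frame_pair[OF tv vv te ee])
  have ecarr: "e \<in> carrier_mat (2 * n) (2 * n)"
    using antisym_mats_dim[OF tripotentD(1)[OF te]] by auto
  \<comment> \<open>Cancelling \<open>det e\<close> turns equality of the determinants into the
    hypothesis of \<open>sim_h_chain_frame\<close> on the product of the \<open>d i\<close>.\<close>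
  have "det e \<noteq> 0"
  proof
    assume "det e = 0"
    moreover have "det (e * mat_adjoint e) = det e * det (mat_adjoint e)"
      using ecarr by (intro det_mult) (auto intro: carrier_matI)
    ultimately show False using ee by simp
  qed
  have chain: "sim_h_chain (2 * n) (2 * n - 1) v e" if "det v = det e"
  proof -
    have "(\<Prod>i<n. d i)\<^sup>2 = 1" using det that \<open>det e \<noteq> 0\<close> by simp
    then show ?thesis
      using isotropic_frame.sim_h_chain_frame[OF fr d[rule_format]] assms(1) by (simp add: ev)
  qed
  have "sim_ht (2 * n) v e" if "det v = det e"
    using sim_h_chain_imp_le_ht[OF chain[OF that]] by (simp add: sim_ht_def)
  moreover have "det v = det e" if "sim_ht (2 * n) v e"
    using le_ht_unitary_imp_det_eq[OF _ vv] that by (auto simp: sim_ht_def)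
  ultimately show ?thesis using chain by blast
qed

end
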